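(* Let $W$ be a set of eight distinct MacMahon cubes such that $G_W$ has eight edges, and let $n$ be the number of connected components of $G_W$. If none of the $n$ connected components is a tree, then the solution number of $W$ for the target $\mathrm{Ba}$ is $2^n$; otherwise it is $0$.
   Context: A MacMahon cube is a cube whose six faces are painted with the colors $1,\dots,6$, each used once, up to rotation (there are $30$ of them). At each vertex three faces meet; reading their colors clockwise as seen from outside gives a cyclic triple, and the corner number of the vertex is the cyclic rotation of this triple of smallest three-digit value; each MacMahon cube has $8$ distinct corner numbers. $\mathrm{Ba}$ denotes the MacMahon cube whose corner numbers are $\{123,134,146,162,253,265,354,456\}$. Every MacMahon cube other than $\mathrm{Ba}$ shares either $0$ or exactly $2$ corner numbers with $\mathrm{Ba}$. $M$ is the multigraph whose vertex set is the $8$ corner numbers of $\mathrm{Ba}$, with one edge, labeled $C$, joining the two shared corner numbers for each MacMahon cube $C\neq\mathrm{Ba}$ sharing exactly two corner numbers with $\mathrm{Ba}$ ($20$ edges, no loops, some parallel pairs). For a set $W$ of MacMahon cubes, $G_W$ is the subgraph of $M$ with all $8$ vertices and exactly the edges labeled by cubes in $W$. A solution for target $\mathrm{Ba}$ is a bijection $\sigma$ from $W$ to the corner numbers of $\mathrm{Ba}$ with $\sigma(C)$ a corner number of $C$ for all $C\in W$; the solution number is the number of such bijections. An isolated vertex counts as a tree component. *)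

theory Defs
  imports "HOL-Library.FuncSet"
begin

section \<open>MacMahon cubes\<close>

datatype face = Up | Down | Front | Back | Left | Right

text \<open>Quarter turns of the whole cube about the vertical axis and about the left-right axis.
  Together they generate the 24 rotations, as permutations of the six face positions.\<close>

fun turn_vertical :: "face \<Rightarrow> face" where
  "turn_vertical Up = Up"
| "turn_vertical Down = Down"
| "turn_vertical Front = Left"
| "turn_vertical Left = Back"
| "turn_vertical Back = Right"
| "turn_vertical Right = Front"

fun turn_horizontal :: "face \<Rightarrow> face" where
  "turn_horizontal Left = Left"
| "turn_horizontal Right = Right"
| "turn_horizontal Front = Up"
| "turn_horizontal Up = Back"
| "turn_horizontal Back = Down"
| "turn_horizontal Down = Front"

inductive_set rotations :: "(face \<Rightarrow> face) set" where
  "id \<in> rotations"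
| "r \<in> rotations \<Longrightarrow> r \<circ> turn_vertical \<in> rotations"
| "r \<in> rotations \<Longrightarrow> r \<circ> turn_horizontal \<in> rotations"

definition colorings :: "(face \<Rightarrow> nat) set" where
  "colorings = {c. bij_betw c UNIV {1..6}}"

definition rotation_rel :: "((face \<Rightarrow> nat) \<times> (face \<Rightarrow> nat)) set" where
  "rotation_rel = {(c, c'). c \<in> colorings \<and> c' \<in> colorings \<and> (\<exists>r\<in>rotations. c' = c \<circ> r)}"

type_synonym cube = "(face \<Rightarrow> nat) set"

definition macmahon_cubes :: "cube set" where
  "macmahon_cubes = colorings // rotation_rel"

text \<open>The eight vertices of the cube, each given by its three faces in clockwise order as seen
  from outside.\<close>

definition cube_vertices :: "(face \<times> face \<times> face) set" where
  "cube_vertices =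
    {(Up, Right, Front), (Up, Front, Left), (Up, Left, Back), (Up, Back, Right),
     (Down, Front, Right), (Down, Left, Front), (Down, Back, Left), (Down, Right, Back)}"

definition corner_number :: "(face \<Rightarrow> nat) \<Rightarrow> face \<times> face \<times> face \<Rightarrow> nat" where
  "corner_number c = (\<lambda>(f, g, h). Min {100 * c f + 10 * c g + c h,
      100 * c g + 10 * c h + c f, 100 * c h + 10 * c f + c g})"

text \<open>All colorings in a rotation class have the same corner numbers, so the union below is the
  common set of corner numbers of the representatives.\<close>

definition corner_numbers :: "cube \<Rightarrow> nat set" where
  "corner_numbers C = (\<Union>c\<in>C. corner_number c ` cube_vertices)"

definition Ba :: cube where
  "Ba = (THE C. C \<in> macmahon_cubes \<and>
    corner_numbers C = {123, 134, 146, 162, 253, 265, 354, 456})"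

text \<open>The functions are taken to be undefined outside \<open>W\<close>, so that each bijection from \<open>W\<close> onto
  the corner numbers of the target is counted once.\<close>

definition solutions :: "cube \<Rightarrow> cube set \<Rightarrow> (cube \<Rightarrow> nat) set" where
  "solutions T W = {\<sigma> \<in> extensional W.
    bij_betw \<sigma> W (corner_numbers T) \<and> (\<forall>C\<in>W. \<sigma> C \<in> corner_numbers C)}"

definition solution_number :: "cube \<Rightarrow> cube set \<Rightarrow> nat" where
  "solution_number T W = card (solutions T W)"


section \<open>Undirected multigraphs\<close>

record ('v, 'e) multigraph =
  mverts :: "'v set"
  medges :: "'e set"
  mends :: "'e \<Rightarrow> 'v set"

text \<open>A walk from \<open>u\<close> is the list of the edges traversed, each paired with the vertex it leads to.\<close>

fun walk :: "('v, 'e) multigraph \<Rightarrow> 'v \<Rightarrow> ('e \<times> 'v) list \<Rightarrow> 'v \<Rightarrow> bool" where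
  "walk G u [] v \<longleftrightarrow> u \<in> mverts G \<and> u = v"
| "walk G u ((e, w) # p) v \<longleftrightarrow>
    u \<in> mverts G \<and> e \<in> medges G \<and> mends G e = {u, w} \<and> walk G w p v"

definition linked :: "('v, 'e) multigraph \<Rightarrow> ('v \<times> 'v) set" where
  "linked G = {(u, v). \<exists>p. walk G u p v}"

definition connected_mgraph :: "('v, 'e) multigraph \<Rightarrow> bool" where
  "connected_mgraph G \<longleftrightarrow>
    mverts G \<noteq> {} \<and> (\<forall>u\<in>mverts G. \<forall>v\<in>mverts G. \<exists>p. walk G u p v)"

text \<open>Two parallel edges form a cycle of length two.\<close>

definition is_cycle :: "('v, 'e) multigraph \<Rightarrow> 'v \<Rightarrow> ('e \<times> 'v) list \<Rightarrow> bool" where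
  "is_cycle G u p \<longleftrightarrow>
    walk G u p u \<and> p \<noteq> [] \<and> distinct (map fst p) \<and> distinct (map snd p)"

definition is_tree :: "('v, 'e) multigraph \<Rightarrow> bool" where
  "is_tree G \<longleftrightarrow> connected_mgraph G \<and> \<not> (\<exists>u p. is_cycle G u p)"

definition induced_mgraph :: "('v, 'e) multigraph \<Rightarrow> 'v set \<Rightarrow> ('v, 'e) multigraph" where
  "induced_mgraph G X =
    \<lparr>mverts = X, medges = {e \<in> medges G. mends G e \<subseteq> X}, mends = mends G\<rparr>"

definition mcomponents :: "('v, 'e) multigraph \<Rightarrow> ('v, 'e) multigraph set" where
  "mcomponents G = induced_mgraph G ` (mverts G // linked G)"


section \<open>The multigraph of shared corner numbers\<close>

definition M :: "(nat, cube) multigraph" where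
  "M = \<lparr>mverts = corner_numbers Ba,
        medges = {C \<in> macmahon_cubes. C \<noteq> Ba \<and> card (corner_numbers C \<inter> corner_numbers Ba) = 2},
        mends = (\<lambda>C. corner_numbers C \<inter> corner_numbers Ba)\<rparr>"

definition G_of :: "cube set \<Rightarrow> (nat, cube) multigraph" where
  "G_of W = M\<lparr>medges := medges M \<inter> W\<rparr>"


section \<open>Well-definedness\<close>

lemma rotations_comp: "r \<in> rotations \<Longrightarrow> s \<in> rotations \<Longrightarrow> r \<circ> s \<in> rotations"
proof -
  assume r: "r \<in> rotations" and "s \<in> rotations"
  from this(2) show ?thesis
  proof (induction s rule: rotations.induct)
    case 1
    show ?case using r by simp
  next
    case (2 s)
    show ?case using rotations.intros(2)[OF 2(2)] by (simp only: o_assoc)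
  next
    case (3 s)
    show ?case using rotations.intros(3)[OF 3(2)] by (simp only: o_assoc)
  qed
qed

lemma turn_vertical_pow4: "turn_vertical \<circ> turn_vertical \<circ> turn_vertical \<circ> turn_vertical = id"
proof
  fix x show "(turn_vertical \<circ> turn_vertical \<circ> turn_vertical \<circ> turn_vertical) x = id x"
    by (cases x) auto
qed

lemma turn_horizontal_pow4:
  "turn_horizontal \<circ> turn_horizontal \<circ> turn_horizontal \<circ> turn_horizontal = id"
proof
  fix x show "(turn_horizontal \<circ> turn_horizontal \<circ> turn_horizontal \<circ> turn_horizontal) x = id x"
    by (cases x) auto
qed

lemma rotations_inverse: "r \<in> rotations \<Longrightarrow> \<exists>s\<in>rotations. r \<circ> s = id \<and> s \<circ> r = id"
proof (induction r rule: rotations.induct)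
  case 1
  show ?case by (rule bexI[OF _ rotations.intros(1)]) simp
next
  case (2 r)
  then obtain s where s: "s \<in> rotations" "r \<circ> s = id" "s \<circ> r = id" by blast
  let ?t = "id \<circ> turn_vertical \<circ> turn_vertical \<circ> turn_vertical"
  have t: "?t \<in> rotations" by (intro rotations.intros)
  have "r \<circ> turn_vertical \<circ> (?t \<circ> s) = id" "?t \<circ> s \<circ> (r \<circ> turn_vertical) = id"
    using s(2,3) turn_vertical_pow4 unfolding fun_eq_iff by simp_all
  then show ?case using rotations_comp[OF t s(1)] by blast
next
  case (3 r)
  then obtain s where s: "s \<in> rotations" "r \<circ> s = id" "s \<circ> r = id" by blast
  let ?t = "id \<circ> turn_horizontal \<circ> turn_horizontal \<circ> turn_horizontal"
  have t: "?t \<in> rotations" by (intro rotations.intros)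
  have "r \<circ> turn_horizontal \<circ> (?t \<circ> s) = id" "?t \<circ> s \<circ> (r \<circ> turn_horizontal) = id"
    using s(2,3) turn_horizontal_pow4 unfolding fun_eq_iff by simp_all
  then show ?case using rotations_comp[OF t s(1)] by blast
qed

lemma colorings_rotation: "c \<in> colorings \<Longrightarrow> r \<in> rotations \<Longrightarrow> c \<circ> r \<in> colorings"
proof -
  assume c: "c \<in> colorings" and r: "r \<in> rotations"
  obtain s where "r \<circ> s = id" "s \<circ> r = id" using rotations_inverse[OF r] by blast
  then have "bij r" using o_bij by blast
  then show ?thesis using c unfolding colorings_def by (auto intro: bij_betw_trans)
qed

lemma equiv_rotation_rel: "equiv colorings rotation_rel"
proof (rule equivI)
  show "rotation_rel \<subseteq> colorings \<times> colorings" by (auto simp: rotation_rel_def)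
  show "refl_on colorings rotation_rel"
    by (auto simp: refl_on_def rotation_rel_def intro!: bexI[OF _ rotations.intros(1)])
  show "sym rotation_rel"
  proof (rule symI)
    fix c c' assume "(c, c') \<in> rotation_rel"
    then obtain r where r: "r \<in> rotations" "c' = c \<circ> r" "c \<in> colorings" "c' \<in> colorings"
      by (auto simp: rotation_rel_def)
    obtain s where s: "s \<in> rotations" "r \<circ> s = id" using rotations_inverse[OF r(1)] by blast
    have "c = c' \<circ> s" using r(2) s(2) by (simp add: o_assoc[symmetric])
    then show "(c', c) \<in> rotation_rel" using r s(1) by (auto simp: rotation_rel_def)
  qed
  show "trans rotation_rel"
  proof (rule transI)
    fix c c' c'' assume "(c, c') \<in> rotation_rel" "(c', c'') \<in> rotation_rel"
    then obtain r s where "r \<in> rotations" "s \<in> rotations" "c' = c \<circ> r" "c'' = c' \<circ> s"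
        "c \<in> colorings" "c'' \<in> colorings"
      by (auto simp: rotation_rel_def)
    then show "(c, c'') \<in> rotation_rel"
      by (auto simp: rotation_rel_def o_assoc intro!: bexI[of _ "r \<circ> s"] rotations_comp)
  qed
qed

lemma corner_numbers_turn:
  "corner_number (c \<circ> turn_vertical) ` cube_vertices = corner_number c ` cube_vertices"
  "corner_number (c \<circ> turn_horizontal) ` cube_vertices = corner_number c ` cube_vertices"
proof -
  have cyc: "corner_number c (g, h, f) = corner_number c (f, g, h)" for f g h
    by (simp add: corner_number_def insert_commute)
  have 1: "corner_number (c \<circ> t) (f, g, h) = corner_number c (t f, t g, t h)" for t f g h
    by (simp add: corner_number_def)
  show "corner_number (c \<circ> turn_vertical) ` cube_vertices = corner_number c ` cube_vertices"
    by (simp add: cube_vertices_def 1 insert_commute)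
  show "corner_number (c \<circ> turn_horizontal) ` cube_vertices = corner_number c ` cube_vertices"
    by (simp add: cube_vertices_def 1 insert_commute)
      (metis (no_types, lifting) cyc insert_commute)
qed

lemma corner_numbers_rotation:
  "r \<in> rotations \<Longrightarrow> corner_number (c \<circ> r) ` cube_vertices = corner_number c ` cube_vertices"
  by (induction r rule: rotations.induct)
    (simp_all only: o_assoc corner_numbers_turn comp_id)

lemma corner_numbers_class:
  assumes "c \<in> colorings"
  shows "corner_numbers (rotation_rel `` {c}) = corner_number c ` cube_vertices"
proof -
  have "c \<in> rotation_rel `` {c}"
    using equiv_class_self[OF equiv_rotation_rel assms] .
  moreover have "corner_number c' ` cube_vertices = corner_number c ` cube_vertices"
    if "c' \<in> rotation_rel `` {c}" for c'
  proof -
    obtain r where "r \<in> rotations" "c' = c \<circ> r"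
      using \<open>c' \<in> rotation_rel `` {c}\<close> by (auto simp: rotation_rel_def)
    then show ?thesis by (simp only: corner_numbers_rotation)
  qed
  ultimately show ?thesis unfolding corner_numbers_def by blast
qed


lemma rotation_to_vertex:
  assumes "v \<in> cube_vertices"
    and "v = (f, g, h) \<or> v = (g, h, f) \<or> v = (h, f, g)"
  shows "\<exists>r\<in>rotations. r Up = f \<and> r Right = g \<and> r Front = h"
proof -
  have *: "r \<in> rotations \<Longrightarrow>
      \<exists>s\<in>rotations. s Up = r Up \<and> s Right = r Right \<and> s Front = r Front" for r
    by blast
  have r0: "\<exists>r\<in>rotations. r Up = Up \<and> r Right = Right \<and> r Front = Front"
    using *[of "id"]
    by (simp add: rotations.intros del: id_o)
  have r1: "\<exists>r\<in>rotations. r Up = Up \<and> r Right = Front \<and> r Front = Left"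
    using *[of "id \<circ> turn_vertical"]
    by (simp add: rotations.intros del: id_o)
  have r2: "\<exists>r\<in>rotations. r Up = Back \<and> r Right = Right \<and> r Front = Up"
    using *[of "id \<circ> turn_horizontal"]
    by (simp add: rotations.intros del: id_o)
  have r3: "\<exists>r\<in>rotations. r Up = Up \<and> r Right = Left \<and> r Front = Back"
    using *[of "id \<circ> turn_vertical \<circ> turn_vertical"]
    by (simp add: rotations.intros del: id_o)
  have r4: "\<exists>r\<in>rotations. r Up = Right \<and> r Right = Front \<and> r Front = Up"
    using *[of "id \<circ> turn_vertical \<circ> turn_horizontal"]
    by (simp add: rotations.intros del: id_o)
  have r5: "\<exists>r\<in>rotations. r Up = Back \<and> r Right = Up \<and> r Front = Left"
    using *[of "id \<circ> turn_horizontal \<circ> turn_vertical"]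
    by (simp add: rotations.intros del: id_o)
  have r6: "\<exists>r\<in>rotations. r Up = Down \<and> r Right = Right \<and> r Front = Back"
    using *[of "id \<circ> turn_horizontal \<circ> turn_horizontal"]
    by (simp add: rotations.intros del: id_o)
  have r7: "\<exists>r\<in>rotations. r Up = Up \<and> r Right = Back \<and> r Front = Right"
    using *[of "id \<circ> turn_vertical \<circ> turn_vertical \<circ> turn_vertical"]
    by (simp add: rotations.intros del: id_o)
  have r8: "\<exists>r\<in>rotations. r Up = Front \<and> r Right = Left \<and> r Front = Up"
    using *[of "id \<circ> turn_vertical \<circ> turn_vertical \<circ> turn_horizontal"]
    by (simp add: rotations.intros del: id_o)
  have r9: "\<exists>r\<in>rotations. r Up = Right \<and> r Right = Up \<and> r Front = Back"
    using *[of "id \<circ> turn_vertical \<circ> turn_horizontal \<circ> turn_vertical"]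
    by (simp add: rotations.intros del: id_o)
  have r10: "\<exists>r\<in>rotations. r Up = Down \<and> r Right = Front \<and> r Front = Right"
    using *[of "id \<circ> turn_vertical \<circ> turn_horizontal \<circ> turn_horizontal"]
    by (simp add: rotations.intros del: id_o)
  have r11: "\<exists>r\<in>rotations. r Up = Back \<and> r Right = Left \<and> r Front = Down"
    using *[of "id \<circ> turn_horizontal \<circ> turn_vertical \<circ> turn_vertical"]
    by (simp add: rotations.intros del: id_o)
  have r12: "\<exists>r\<in>rotations. r Up = Down \<and> r Right = Back \<and> r Front = Left"
    using *[of "id \<circ> turn_horizontal \<circ> turn_horizontal \<circ> turn_vertical"]
    by (simp add: rotations.intros del: id_o)
  have r13: "\<exists>r\<in>rotations. r Up = Front \<and> r Right = Right \<and> r Front = Down"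
    using *[of "id \<circ> turn_horizontal \<circ> turn_horizontal \<circ> turn_horizontal"]
    by (simp add: rotations.intros del: id_o)
  have r14: "\<exists>r\<in>rotations. r Up = Left \<and> r Right = Back \<and> r Front = Up"
    using *[of "id \<circ> turn_vertical \<circ> turn_vertical \<circ> turn_vertical \<circ> turn_horizontal"]
    by (simp add: rotations.intros del: id_o)
  have r15: "\<exists>r\<in>rotations. r Up = Front \<and> r Right = Up \<and> r Front = Right"
    using *[of "id \<circ> turn_vertical \<circ> turn_vertical \<circ> turn_horizontal \<circ> turn_vertical"]
    by (simp add: rotations.intros del: id_o)
  have r16: "\<exists>r\<in>rotations. r Up = Down \<and> r Right = Left \<and> r Front = Front"
    using *[of "id \<circ> turn_vertical \<circ> turn_vertical \<circ> turn_horizontal \<circ> turn_horizontal"]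
    by (simp add: rotations.intros del: id_o)
  have r17: "\<exists>r\<in>rotations. r Up = Right \<and> r Right = Back \<and> r Front = Down"
    using *[of "id \<circ> turn_vertical \<circ> turn_horizontal \<circ> turn_vertical \<circ> turn_vertical"]
    by (simp add: rotations.intros del: id_o)
  have r18: "\<exists>r\<in>rotations. r Up = Left \<and> r Right = Front \<and> r Front = Down"
    using *[of "id \<circ> turn_vertical \<circ> turn_horizontal \<circ> turn_horizontal \<circ> turn_horizontal"]
    by (simp add: rotations.intros del: id_o)
  have r19: "\<exists>r\<in>rotations. r Up = Back \<and> r Right = Down \<and> r Front = Right"
    using *[of "id \<circ> turn_horizontal \<circ> turn_vertical \<circ> turn_vertical \<circ> turn_vertical"]
    by (simp add: rotations.intros del: id_o)
  have r20: "\<exists>r\<in>rotations. r Up = Front \<and> r Right = Down \<and> r Front = Left"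
    using *[of "id \<circ> turn_horizontal \<circ> turn_horizontal \<circ> turn_horizontal \<circ> turn_vertical"]
    by (simp add: rotations.intros del: id_o)
  have r21: "\<exists>r\<in>rotations. r Up = Left \<and> r Right = Up \<and> r Front = Front"
    using *[of "id \<circ> turn_vertical \<circ> turn_vertical \<circ> turn_vertical \<circ> turn_horizontal \<circ> turn_vertical"]
    by (simp add: rotations.intros del: id_o)
  have r22: "\<exists>r\<in>rotations. r Up = Right \<and> r Right = Down \<and> r Front = Front"
    using *[of "id \<circ> turn_vertical \<circ> turn_horizontal \<circ> turn_vertical \<circ> turn_vertical \<circ> turn_vertical"]
    by (simp add: rotations.intros del: id_o)
  have r23: "\<exists>r\<in>rotations. r Up = Left \<and> r Right = Down \<and> r Front = Back"
    using *[of "id \<circ> turn_vertical \<circ> turn_horizontal \<circ> turn_horizontal \<circ> turn_horizontal \<circ> turn_vertical"]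
    by (simp add: rotations.intros del: id_o)
  show ?thesis
    using assms r0 r1 r2 r3 r4 r5 r6 r7 r8 r9 r10 r11 r12 r13 r14 r15 r16 r17 r18 r19 r20 r21 r22 r23
    unfolding cube_vertices_def by (elim insertE disjE emptyE; simp)
qed


lemma corner_number_123:
  assumes c: "c \<in> colorings" and n: "corner_number c v = 123"
  shows "\<exists>f g h. (v = (f, g, h) \<or> v = (g, h, f) \<or> v = (h, f, g)) \<and> c f = 1 \<and> c g = 2 \<and> c h = 3"
proof -
  obtain f g h where v: "v = (f, g, h)" by (cases v)
  have rng: "c x \<le> 6" for x
    using c bij_betwE unfolding colorings_def by fastforce
  have digits: "x = 1 \<and> y = 2 \<and> z = 3"
    if "100 * x + 10 * y + z = (123::nat)" "x \<le> 6" "y \<le> 6" "z \<le> 6" for x y z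
  proof -
    have "x = 1" using that by linarith
    moreover from this have "y = 2" using that by linarith
    ultimately show ?thesis using that by linarith
  qed
  have "corner_number c v \<in> {100 * c f + 10 * c g + c h,
      100 * c g + 10 * c h + c f, 100 * c h + 10 * c f + c g}"
    unfolding v corner_number_def prod.case by (rule Min_in) auto
  then consider "100 * c f + 10 * c g + c h = 123" | "100 * c g + 10 * c h + c f = 123"
    | "100 * c h + 10 * c f + c g = 123"
    using n by auto
  then show ?thesis
    unfolding v by cases (blast dest: digits[OF _ rng rng rng])+
qed

definition Ba_coloring :: "face \<Rightarrow> nat" where
  "Ba_coloring x = (case x of Up \<Rightarrow> 1 | Right \<Rightarrow> 2 | Front \<Rightarrow> 3 | Left \<Rightarrow> 4 | Down \<Rightarrow> 5 | Back \<Rightarrow> 6)"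

lemma UNIV_face: "UNIV = {Up, Down, Front, Back, Left, Right}"
  using face.exhaust by auto

lemma Ba_coloring: "Ba_coloring \<in> colorings"
proof -
  have "inj Ba_coloring" by (auto simp: inj_def Ba_coloring_def split: face.splits)
  moreover have "range Ba_coloring = {1..6}" by (auto simp: UNIV_face Ba_coloring_def)
  ultimately show ?thesis by (simp add: colorings_def bij_betw_def)
qed

lemma Ba_coloring_corner_numbers:
  "corner_number Ba_coloring ` cube_vertices = {123, 134, 146, 162, 253, 265, 354, 456}"
  by (auto simp: cube_vertices_def corner_number_def Ba_coloring_def)

lemma coloring_eq_Ba_coloring:
  assumes c: "c \<in> colorings" and "c Up = 1" "c Right = 2" "c Front = 3"
    and n: "corner_number c ` cube_vertices = {123, 134, 146, 162, 253, 265, 354, 456}"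
  shows "c = Ba_coloring"
proof -
  have inj: "inj c" and rng: "range c = {1..6}"
    using c by (auto simp: colorings_def bij_betw_def)
  have *: "c x \<in> {4, 5, 6}" if "x \<in> {Left, Down, Back}" for x
  proof -
    have "c x \<in> {1..6}" using rng by blast
    moreover have "c x \<noteq> c Up" "c x \<noteq> c Right" "c x \<noteq> c Front"
      using that inj by (auto dest: injD)
    ultimately show ?thesis using assms(2-4) by auto
  qed
  have N: "corner_number c v \<in> {123, 134, 146, 162, 253, 265, 354, 456}"
    if "v \<in> cube_vertices" for v
    unfolding n[symmetric] using that by blast
  have "corner_number c (Up, Front, Left) = 130 + c Left"
    using *[of Left] assms(2-4) by (auto simp: corner_number_def)
  then have "c Left = 4"
    using N[of "(Up, Front, Left)"] *[of Left] by (auto simp: cube_vertices_def)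
  moreover have "corner_number c (Up, Back, Right) = 102 + 10 * c Back"
    using *[of Back] assms(2-4) by (auto simp: corner_number_def)
  then have "c Back = 6"
    using N[of "(Up, Back, Right)"] *[of Back] by (auto simp: cube_vertices_def; presburger)
  ultimately have "c Left = 4" "c Back = 6" by simp_all
  moreover from this have "c Down = 5"
    using *[of Down] inj_eq[OF inj, of Down Left] inj_eq[OF inj, of Down Back] by auto
  ultimately show ?thesis
    using assms(2-4) unfolding fun_eq_iff Ba_coloring_def by (simp split: face.split)
qed

lemma Ba_ex1: "\<exists>!C. C \<in> macmahon_cubes \<and>
    corner_numbers C = {123, 134, 146, 162, 253, 265, 354, 456}"
proof (rule ex1I)
  show "rotation_rel `` {Ba_coloring} \<in> macmahon_cubes \<and>
    corner_numbers (rotation_rel `` {Ba_coloring}) = {123, 134, 146, 162, 253, 265, 354, 456}"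
    using Ba_coloring Ba_coloring_corner_numbers corner_numbers_class quotientI
    unfolding macmahon_cubes_def by metis
next
  fix C
  assume C: "C \<in> macmahon_cubes \<and> corner_numbers C = {123, 134, 146, 162, 253, 265, 354, 456}"
  then obtain c where c: "c \<in> colorings" "C = rotation_rel `` {c}"
    unfolding macmahon_cubes_def by (auto elim: quotientE)
  have n: "corner_number c ` cube_vertices = {123, 134, 146, 162, 253, 265, 354, 456}"
    using C c corner_numbers_class by simp
  then have "123 \<in> corner_number c ` cube_vertices" by simp
  then obtain v where v: "v \<in> cube_vertices" "corner_number c v = 123" by (metis imageE)
  then obtain f g h where fgh: "v = (f, g, h) \<or> v = (g, h, f) \<or> v = (h, f, g)"
      "c f = 1" "c g = 2" "c h = 3"
    using corner_number_123[OF c(1) v(2)] by blast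
  obtain r where r: "r \<in> rotations" "r Up = f" "r Right = g" "r Front = h"
    using rotation_to_vertex[OF v(1) fgh(1)] by blast
  have "c \<circ> r = Ba_coloring"
    by (rule coloring_eq_Ba_coloring)
      (simp_all add: colorings_rotation c(1) r fgh n corner_numbers_rotation del: comp_apply,
       simp_all add: r fgh)
  then have "(c, Ba_coloring) \<in> rotation_rel"
    using c(1) r(1) Ba_coloring unfolding rotation_rel_def mem_Collect_eq prod.case by metis
  then show "C = rotation_rel `` {Ba_coloring}"
    using c(2) equiv_class_eq[OF equiv_rotation_rel] by simp
qed

lemma Ba: "Ba \<in> macmahon_cubes" "corner_numbers Ba = {123, 134, 146, 162, 253, 265, 354, 456}"
  using theI'[OF Ba_ex1] unfolding Ba_def by blast+

end

theory Submission
  imports Defs "HOL-Library.Disjoint_Sets"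
begin

text \<open>
  A solution assigns to every edge of \<open>G\<^sub>W\<close> one of its ends, each vertex being used exactly once.
  Such an assignment restricts to every connected component, so the number of solutions is the
  product of the numbers of assignments of the components. Sending a vertex to the other end of the
  edge assigned to it and iterating, one runs into a cycle, so a tree admits no assignment. A
  connected graph with a cycle arises from the cycle by attaching leaves and then adding edges; it
  therefore has at least as many edges as vertices. If no component is a tree, all these
  inequalities are equalities because \<open>G\<^sub>W\<close> has as many edges as vertices. Then each component is a
  cycle with leaves attached successively; the edge to a leaf must be assigned to the leaf, and the
  cycle can be assigned in exactly two ways, one for each orientation.
\<close>

section \<open>Transversals\<close>

text \<open>These are the systems of distinct representatives of the sets \<open>N e\<close> that
  use up all of \<open>S\<close>. The sets \<open>N e\<close> may reach outside \<open>S\<close>, so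
  vertices can be deleted while \<open>N\<close> stays fixed; extensionality makes each assignment
  count once.\<close>

definition transversals :: "('e \<Rightarrow> 'v set) \<Rightarrow> 'e set \<Rightarrow> 'v set \<Rightarrow> ('e \<Rightarrow> 'v) set" where
  "transversals N F S = {\<sigma> \<in> extensional F. bij_betw \<sigma> F S \<and> (\<forall>e\<in>F. \<sigma> e \<in> N e)}"

lemma finite_transversals:
  assumes "finite F" "finite S"
  shows "finite (transversals N F S)"
proof (rule finite_subset)
  show "transversals N F S \<subseteq> F \<rightarrow>\<^sub>E S"
    by (auto simp: transversals_def PiE_def dest: bij_betwE)
  show "finite (F \<rightarrow>\<^sub>E S)" using assms by (rule finite_PiE)
qed

lemma transversals_empty: "transversals N {} {} = {\<lambda>_. undefined}"
  by (auto simp: transversals_def bij_betw_def)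

text \<open>This discards the losing branches of the recursions below: some vertex is left that no
  remaining edge can take.\<close>

lemma transversals_uncovered:
  assumes "w \<in> S" "\<And>e. e \<in> F \<Longrightarrow> w \<notin> N e"
  shows "transversals N F S = {}"
proof -
  have False if "\<sigma> \<in> transversals N F S" for \<sigma>
  proof -
    have "w \<in> \<sigma> ` F" using that assms(1) by (simp add: transversals_def bij_betw_def)
    then show False using that assms(2) by (auto simp: transversals_def)
  qed
  then show ?thesis by blast
qed

section \<open>Expansion along an edge and forced choices\<close>

text \<open>Cases on the vertex taken by \<open>e\<close>, as in expanding a permanent along a row;
  the other edges must then share out the rest of \<open>S\<close>.\<close>

lemma card_transversals_insert:
  assumes "finite F" "finite S" "e \<notin> F"
  shows "card (transversals N (insert e F) S) = (\<Sum>x\<in>N e \<inter> S. card (transversals N F (S - {x})))"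
proof -
  \<comment> \<open>As \<open>e\<close> is outside \<open>F\<close>, an extensional
    \<open>\<tau>\<close> is \<open>undefined\<close> there, so resetting \<open>e\<close> recovers
    it.\<close>
  let ?f = "\<lambda>(x, \<tau>). \<tau>(e := x)" and ?g = "\<lambda>\<sigma>. (\<sigma> e, \<sigma>(e := undefined))"
  let ?A = "SIGMA x:N e \<inter> S. transversals N F (S - {x})"
  have 1: "\<tau>(e := x) \<in> transversals N (insert e F) S"
    if x: "x \<in> N e \<inter> S" and t: "\<tau> \<in> transversals N F (S - {x})" for x \<tau>
  proof -
    have b: "bij_betw \<tau> F (S - {x})" using t by (simp add: transversals_def)
    have "bij_betw (\<tau>(e := x)) F (S - {x})"
      using b assms(3) by (subst bij_betw_cong[of F _ \<tau>]) auto
    then have "bij_betw (\<tau>(e := x)) (insert e F) (insert x (S - {x}))"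
      using assms(3) notIn_Un_bij_betw[of e F "\<tau>(e := x)" "S - {x}"] by simp
    moreover have "insert x (S - {x}) = S" using x by auto
    ultimately show ?thesis
      using t x assms(3) by (auto simp: transversals_def extensional_def)
  qed
  have 2: "\<sigma> e \<in> N e \<inter> S" "\<sigma>(e := undefined) \<in> transversals N F (S - {\<sigma> e})"
    if s: "\<sigma> \<in> transversals N (insert e F) S" for \<sigma>
  proof -
    have b: "bij_betw \<sigma> (insert e F) S" using s by (simp add: transversals_def)
    show "\<sigma> e \<in> N e \<inter> S" using s bij_betwE[OF b] by (auto simp: transversals_def)
    have "bij_betw \<sigma> F (S - {\<sigma> e})"
      using b assms(3) by (auto simp: bij_betw_def) (metis imageI)
    then have "bij_betw (\<sigma>(e := undefined)) F (S - {\<sigma> e})"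
      using assms(3) by (subst bij_betw_cong[of F _ \<sigma>]) auto
    then show "\<sigma>(e := undefined) \<in> transversals N F (S - {\<sigma> e})"
      using s assms(3) by (auto simp: transversals_def extensional_def)
  qed
  have "bij_betw ?f ?A (transversals N (insert e F) S)"
  proof (rule bij_betw_byWitness[where f' = ?g])
    show "\<forall>a\<in>?A. ?g (?f a) = a"
      using assms(3) by (auto simp: transversals_def extensional_def fun_eq_iff)
    show "\<forall>\<sigma>\<in>transversals N (insert e F) S. ?f (?g \<sigma>) = \<sigma>" by simp
    show "?f ` ?A \<subseteq> transversals N (insert e F) S" using 1 by auto
    show "?g ` transversals N (insert e F) S \<subseteq> ?A" using 2 by blast
  qed
  then have "card (transversals N (insert e F) S) = card ?A"
    using bij_betw_same_card by fastforce
  also have "\<dots> = (\<Sum>x\<in>N e \<inter> S. card (transversals N F (S - {x})))"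
    by (rule card_SigmaI) (use assms in \<open>auto intro: finite_transversals\<close>)
  finally show ?thesis .
qed

lemma card_transversals_insert_unique:
  assumes "finite F" "finite S" "e \<notin> F" "x \<in> N e" "x \<in> S"
    and "\<And>y. y \<in> N e \<inter> S \<Longrightarrow> y \<noteq> x \<Longrightarrow> transversals N F (S - {y}) = {}"
  shows "card (transversals N (insert e F) S) = card (transversals N F (S - {x}))"
proof -
  have "(\<Sum>y\<in>N e \<inter> S. card (transversals N F (S - {y}))) =
      (\<Sum>y\<in>{x}. card (transversals N F (S - {y})))"
    using assms by (intro sum.mono_neutral_right) auto
  then show ?thesis using card_transversals_insert[OF assms(1-3)] by simp
qed

text \<open>If \<open>e\<close> took a vertex other than \<open>w\<close>, then \<open>w\<close>
  would be left to the edges in \<open>F\<close>, which all miss it. So the choice for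
  \<open>e\<close> is forced.\<close>

lemma card_transversals_leaf:
  assumes "finite F" "finite S" "e \<notin> F" "w \<in> N e" "w \<notin> S" "\<And>f. f \<in> F \<Longrightarrow> w \<notin> N f"
  shows "card (transversals N (insert e F) (insert w S)) = card (transversals N F S)"
proof -
  have "card (transversals N (insert e F) (insert w S)) =
      card (transversals N F (insert w S - {w}))"
  proof (rule card_transversals_insert_unique)
    show "transversals N F (insert w S - {y}) = {}" if "y \<noteq> w" for y
      using that assms(6) by (intro transversals_uncovered[of w]) auto
  qed (use assms in auto)
  then show ?thesis using assms(5) by simp
qed

section \<open>Product formula for disjoint pieces\<close>

text \<open>Edges in \<open>F\<close> can only take vertices in \<open>S\<close>, and those in
  \<open>F'\<close> only vertices in \<open>S'\<close>, so a transversal is a pair of independent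
  ones.\<close>

lemma card_transversals_Un:
  assumes "F \<inter> F' = {}" "S \<inter> S' = {}"
    and N: "\<And>e. e \<in> F \<Longrightarrow> N e \<subseteq> S" and N': "\<And>e. e \<in> F' \<Longrightarrow> N e \<subseteq> S'"
  shows "card (transversals N (F \<union> F') (S \<union> S')) =
    card (transversals N F S) * card (transversals N F' S')"
proof -
  let ?f = "\<lambda>\<sigma>. (restrict \<sigma> F, restrict \<sigma> F')"
    and ?g = "\<lambda>(\<tau>, \<tau>'). \<lambda>e. if e \<in> F then \<tau> e else \<tau>' e"
  \<comment> \<open>Stated for arbitrary pieces so that it also applies with the two roles
    exchanged.\<close>
  have restr: "restrict \<sigma> A \<in> transversals N A T"
    if s: "\<sigma> \<in> transversals N (A \<union> A') (T \<union> T')" and "T \<inter> T' = {}"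
      and NA: "\<And>e. e \<in> A \<Longrightarrow> N e \<subseteq> T" "\<And>e. e \<in> A' \<Longrightarrow> N e \<subseteq> T'" for \<sigma> A A' T T'
  proof -
    have b: "bij_betw \<sigma> (A \<union> A') (T \<union> T')" and in_N: "\<And>e. e \<in> A \<union> A' \<Longrightarrow> \<sigma> e \<in> N e"
      using s by (auto simp: transversals_def)
    have "\<sigma> ` A = T"
    proof
      show "\<sigma> ` A \<subseteq> T" using in_N NA by blast
      show "T \<subseteq> \<sigma> ` A"
      proof
        fix x assume x: "x \<in> T"
        then obtain e where e: "e \<in> A \<union> A'" "x = \<sigma> e"
          using b unfolding bij_betw_def by blast
        \<comment> \<open>An edge of \<open>A'\<close> would place \<open>x\<close> in
          \<open>T'\<close> as well as in \<open>T\<close>.\<close>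
        then have "e \<notin> A'" using in_N NA(2) \<open>T \<inter> T' = {}\<close> x by blast
        then show "x \<in> \<sigma> ` A" using e by blast
      qed
    qed
    then have "bij_betw \<sigma> A T"
      using b by (auto simp: bij_betw_def intro: inj_on_subset)
    then show ?thesis using in_N by (auto simp: transversals_def)
  qed
  have "bij_betw ?f (transversals N (F \<union> F') (S \<union> S')) (transversals N F S \<times> transversals N F' S')"
  proof (rule bij_betw_byWitness[where f' = ?g])
    show "\<forall>\<sigma>\<in>transversals N (F \<union> F') (S \<union> S'). ?g (?f \<sigma>) = \<sigma>"
      by (auto simp: transversals_def extensional_def fun_eq_iff)
    show "\<forall>a\<in>transversals N F S \<times> transversals N F' S'. ?f (?g a) = a"
      using assms(1) by (force simp: transversals_def extensional_def fun_eq_iff)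
    show "?f ` transversals N (F \<union> F') (S \<union> S') \<subseteq> transversals N F S \<times> transversals N F' S'"
    proof (clarify, intro conjI)
      fix \<sigma> assume s: "\<sigma> \<in> transversals N (F \<union> F') (S \<union> S')"
      show "restrict \<sigma> F \<in> transversals N F S" using restr[OF s assms(2-4)] .
      have s': "\<sigma> \<in> transversals N (F' \<union> F) (S' \<union> S)" using s by (simp add: Un_commute)
      show "restrict \<sigma> F' \<in> transversals N F' S'"
        using restr[OF s' _ N' N] assms(2) by (simp add: Int_commute)
    qed
    show "?g ` (transversals N F S \<times> transversals N F' S') \<subseteq> transversals N (F \<union> F') (S \<union> S')"
    proof clarify
      fix \<tau> \<tau>' assume t: "\<tau> \<in> transversals N F S" "\<tau>' \<in> transversals N F' S'"
      let ?\<sigma> = "\<lambda>e. if e \<in> F then \<tau> e else \<tau>' e"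
      have "bij_betw ?\<sigma> F S"
        using t(1) by (subst bij_betw_cong[of F _ \<tau>]) (auto simp: transversals_def)
      moreover have "bij_betw ?\<sigma> F' S'"
        using t(2) assms(1) by (subst bij_betw_cong[of F' _ \<tau>']) (auto simp: transversals_def)
      ultimately have "bij_betw ?\<sigma> (F \<union> F') (S \<union> S')"
        using assms(2) by (rule bij_betw_combine)
      then show "?\<sigma> \<in> transversals N (F \<union> F') (S \<union> S')"
        using t by (auto simp: transversals_def extensional_def)
    qed
  qed
  from bij_betw_same_card[OF this] show ?thesis by (simp add: card_cartesian_product)
qed

lemma card_transversals_UN:
  assumes "finite P" "disjoint_family_on B P" "disjoint_family_on A P"
    and "\<And>i e. i \<in> P \<Longrightarrow> e \<in> A i \<Longrightarrow> N e \<subseteq> B i"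
  shows "card (transversals N (\<Union>i\<in>P. A i) (\<Union>i\<in>P. B i)) =
    (\<Prod>i\<in>P. card (transversals N (A i) (B i)))"
  using assms
proof (induction P rule: finite_induct)
  case empty
  show ?case by (simp add: transversals_empty)
next
  case (insert i P)
  have "card (transversals N (A i \<union> (\<Union>i\<in>P. A i)) (B i \<union> (\<Union>i\<in>P. B i))) =
      card (transversals N (A i) (B i)) * card (transversals N (\<Union>i\<in>P. A i) (\<Union>i\<in>P. B i))"
  proof (rule card_transversals_Un)
    show "A i \<inter> (\<Union>i\<in>P. A i) = {}" "B i \<inter> (\<Union>i\<in>P. B i) = {}"
      using insert.hyps insert.prems(1,2) by (auto simp: disjoint_family_on_insert)
    show "N e \<subseteq> B i" if "e \<in> A i" for e using that insert.prems(3) by blast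
    show "N e \<subseteq> (\<Union>i\<in>P. B i)" if "e \<in> (\<Union>i\<in>P. A i)" for e
      using that insert.prems(3) by blast
  qed
  moreover have "card (transversals N (\<Union>i\<in>P. A i) (\<Union>i\<in>P. B i)) =
      (\<Prod>i\<in>P. card (transversals N (A i) (B i)))"
    using insert.hyps insert.prems
    by (intro insert.IH) (auto simp: disjoint_family_on_insert)
  ultimately show ?case using insert.hyps by simp
qed

section \<open>Walks and cycles\<close>

lemma walk_append:
  "walk G u p v \<Longrightarrow> walk G v q w \<Longrightarrow> walk G u (p @ q) w"
  by (induction G u p v rule: walk.induct) auto

lemma walk_ends: "walk G u p v \<Longrightarrow> u \<in> mverts G \<and> v \<in> mverts G"
  by (induction G u p v rule: walk.induct) auto

lemma walk_rev: "walk G u p v \<Longrightarrow> \<exists>q. walk G v q u"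
proof (induction G u p v rule: walk.induct)
  case (1 G u v)
  then have "walk G v [] u" by auto
  then show ?case by blast
next
  case (2 G u e w p v)
  then obtain q where q: "walk G v q w" by auto
  have "walk G w [(e, u)] u"
    using 2(2) walk_ends[of G w p v] by (auto simp: insert_commute)
  from walk_append[OF q this] show ?case by blast
qed

lemma walk_mends_subset:
  "walk G u p v \<Longrightarrow> e \<in> fst ` set p \<Longrightarrow> mends G e \<subseteq> insert u (snd ` set p)"
  by (induction G u p v rule: walk.induct) auto

lemma walk_last: "walk G u p v \<Longrightarrow> v = last (u # map snd p)"
  by (induction G u p v rule: walk.induct) auto

lemma walk_medges: "walk G u p v \<Longrightarrow> fst ` set p \<subseteq> medges G"
  by (induction G u p v rule: walk.induct) auto

lemma walk_mverts: "walk G u p v \<Longrightarrow> snd ` set p \<subseteq> mverts G"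
  by (induction G u p v rule: walk.induct) (auto dest: walk_ends)

section \<open>Transversals of paths and cycles\<close>

text \<open>The first edge cannot take the missing start, so it takes its far end, which is then
  missing for the rest of the path: every edge takes the vertex it leads to.\<close>

lemma card_transversals_path_without_start:
  assumes "walk G u p v" "distinct (map fst p)" "distinct (u # map snd p)"
  shows "card (transversals (mends G) (fst ` set p) (snd ` set p)) = 1"
  using assms
proof (induction G u p v rule: walk.induct)
  case (1 G u v)
  then show ?case by (simp add: transversals_empty)
next
  case (2 G u e w p v)
  have "card (transversals (mends G) (insert e (fst ` set p)) (insert w (snd ` set p))) =
      card (transversals (mends G) (fst ` set p) (insert w (snd ` set p) - {w}))"
    using 2(2-4) by (intro card_transversals_insert_unique) auto
  then show ?case using 2 by simp
qed

text \<open>Only the first edge contains the start, so it must take it; inductively every edge takes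
  the vertex it leaves.\<close>

lemma card_transversals_path_without_end:
  assumes "walk G u p v" "distinct (map fst p)" "distinct (u # map snd p)"
  shows "card (transversals (mends G) (fst ` set p) (insert u (snd ` set p) - {v})) = 1"
  using assms
proof (induction G u p v rule: walk.induct)
  case (1 G u v)
  then show ?case by (simp add: transversals_empty)
next
  case (2 G u e w p v)
  let ?S = "insert u (insert w (snd ` set p)) - {v}"
  have walk: "walk G w p v" and e: "mends G e = {u, w}" and uw: "u \<notin> insert w (snd ` set p)"
    using 2(2,4) by auto
  \<comment> \<open>The start is never revisited, so it differs from the removed end and still has
    to be covered.\<close>
  have "v \<in> insert w (snd ` set p)"
    using walk_last[OF walk] last_in_set[of "w # map snd p"] by auto
  then have uv: "u \<noteq> v" using uw by blast
  have "card (transversals (mends G) (insert e (fst ` set p)) ?S) =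
      card (transversals (mends G) (fst ` set p) (?S - {u}))"
  proof (rule card_transversals_insert_unique)
    show "transversals (mends G) (fst ` set p) (?S - {y}) = {}" if "y \<noteq> u" for y
      using that uv uw walk_mends_subset[OF walk] by (intro transversals_uncovered[of u]) auto
  qed (use 2(3) e uv in auto)
  moreover have "?S - {u} = insert w (snd ` set p) - {v}" using uw uv by auto
  ultimately show ?case using 2 by simp
qed

text \<open>Removing the first edge \<open>e\<close> leaves a path from \<open>w\<close> to
  \<open>u\<close>. If \<open>e\<close> takes \<open>u\<close>, the path lacks its end; if
  \<open>e\<close> takes \<open>w\<close>, it lacks its start; each case has one completion. The
  hypothesis on cardinalities excludes a loop, where the two cases would coincide.\<close>

lemma card_transversals_cycle:
  assumes cyc: "is_cycle G u p" and card2: "\<And>e. e \<in> medges G \<Longrightarrow> card (mends G e) = 2"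
  shows "card (transversals (mends G) (fst ` set p) (snd ` set p)) = 2"
proof -
  obtain e w q where p: "p = (e, w) # q"
    using cyc unfolding is_cycle_def by (metis list.exhaust surj_pair)
  let ?F = "fst ` set q" and ?S = "insert w (snd ` set q)"
  have q: "walk G w q u" "distinct (map fst q)" "distinct (w # map snd q)"
    and e: "e \<in> medges G" "mends G e = {u, w}" "e \<notin> ?F"
    using cyc by (auto simp: is_cycle_def p)
  have uw: "u \<noteq> w" using card2[OF e(1)] e(2) by auto
  have "u \<in> ?S"
    using walk_last[OF q(1)] last_in_set[of "w # map snd q"] by auto
  then have "mends G e \<inter> ?S = {u, w}" using e(2) by auto
  then have "card (transversals (mends G) (insert e ?F) ?S) =
      (\<Sum>x\<in>{u, w}. card (transversals (mends G) ?F (?S - {x})))"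
    using card_transversals_insert[of ?F ?S e "mends G"] e(3) by simp
  also have "\<dots> = 1 + card (transversals (mends G) ?F (?S - {w}))"
    using uw card_transversals_path_without_end[OF q] by simp
  also have "?S - {w} = snd ` set q" using q(3) by auto
  finally show ?thesis using card_transversals_path_without_start[OF q] by (simp add: p)
qed

section \<open>From a transversal to a cycle\<close>

lemma walk_iterate:
  assumes "\<And>x. x \<in> mverts G \<Longrightarrow> f x \<in> mverts G \<and> t x \<in> medges G \<and> mends G (t x) = {x, f x}"
    and "v \<in> mverts G"
  shows "walk G v (map (\<lambda>i. (t ((f ^^ i) v), (f ^^ Suc i) v)) [0..<k]) ((f ^^ k) v)"
proof (induction k)
  case 0
  show ?case using assms(2) by simp
next
  case (Suc k)
  have "(f ^^ k) v \<in> mverts G" using walk_ends[OF Suc] by blast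
  then have "walk G ((f ^^ k) v) [(t ((f ^^ k) v), (f ^^ Suc k) v)] ((f ^^ Suc k) v)"
    using assms(1) by auto
  from walk_append[OF Suc this] show ?case by simp
qed

text \<open>Each vertex \<open>x\<close> owns an edge \<open>t x\<close>, and crossing it defines a
  self-map \<open>f\<close> of a finite set, which has a periodic point. A point of least period
  traces a cycle: its vertices are distinct by minimality, its edges because \<open>t\<close> is
  injective.\<close>

lemma transversal_imp_cycle:
  assumes s: "\<sigma> \<in> transversals (mends G) (medges G) (mverts G)"
    and fin: "finite (mverts G)" and ne: "mverts G \<noteq> {}"
    and ends: "\<And>e. e \<in> medges G \<Longrightarrow> mends G e \<subseteq> mverts G \<and> card (mends G e) = 2"
  shows "\<exists>u p. is_cycle G u p"
proof -
  define t where "t = inv_into (medges G) \<sigma>"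
  have b: "bij_betw \<sigma> (medges G) (mverts G)" and in_ends: "\<And>e. e \<in> medges G \<Longrightarrow> \<sigma> e \<in> mends G e"
    using s by (auto simp: transversals_def)
  have t: "bij_betw t (mverts G) (medges G)"
    unfolding t_def by (rule bij_betw_inv_into[OF b])
  have t_ends: "x \<in> mends G (t x)" if "x \<in> mverts G" for x
    using in_ends[of "t x"] that bij_betwE[OF t] bij_betw_inv_into_right[OF b]
    unfolding t_def by fastforce
  have "\<exists>y. mends G (t x) = {x, y}" if x: "x \<in> mverts G" for x
  proof -
    obtain a c where "mends G (t x) = {a, c}"
      using ends[of "t x"] x bij_betwE[OF t] by (auto simp: card_2_iff)
    then show ?thesis using t_ends[OF x] by (auto simp: insert_commute)
  qed
  then obtain f where f: "\<And>x. x \<in> mverts G \<Longrightarrow> mends G (t x) = {x, f x}" by metis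
  have step: "f x \<in> mverts G \<and> t x \<in> medges G \<and> mends G (t x) = {x, f x}" if "x \<in> mverts G" for x
    using f[OF that] ends[of "t x"] bij_betwE[OF t] that by auto
  have iter: "(f ^^ i) x \<in> mverts G" if "x \<in> mverts G" for i x
    using walk_ends[OF walk_iterate[of G f t, OF step that]] by blast
  obtain x where x: "x \<in> mverts G" using ne by blast
  \<comment> \<open>Pigeonhole: an orbit in a finite set repeats, and the repeated vertex is
    periodic.\<close>
  have "\<exists>k>0. \<exists>v\<in>mverts G. (f ^^ k) v = v"
  proof -
    have "\<not> inj_on (\<lambda>i. (f ^^ i) x) UNIV"
    proof
      assume "inj_on (\<lambda>i. (f ^^ i) x) UNIV"
      moreover have "range (\<lambda>i. (f ^^ i) x) \<subseteq> mverts G" using iter[OF x] by blast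
      then have "finite (range (\<lambda>i. (f ^^ i) x))" using fin finite_subset by blast
      ultimately show False using finite_imageD by blast
    qed
    then obtain i j where ij: "i < j" "(f ^^ i) x = (f ^^ j) x"
      unfolding inj_on_def by (metis linorder_neqE_nat)
    then have "(f ^^ (j - i)) ((f ^^ i) x) = (f ^^ i) x"
      by (metis comp_apply funpow_add le_add_diff_inverse2 less_imp_le)
    then show ?thesis using ij(1) iter[OF x] by (meson zero_less_diff)
  qed
  \<comment> \<open>The minimum ranges over the periods of all vertices, so an early return at any
    point of the orbit contradicts it, not only one at \<open>v\<close>.\<close>
  define k where "k = (LEAST k. k > 0 \<and> (\<exists>v\<in>mverts G. (f ^^ k) v = v))"
  have k: "k > 0 \<and> (\<exists>v\<in>mverts G. (f ^^ k) v = v)"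
    unfolding k_def by (rule LeastI_ex) (use \<open>\<exists>k>0. _\<close> in blast)
  then obtain v where v: "v \<in> mverts G" "(f ^^ k) v = v" by blast
  have no: "(f ^^ i) v \<noteq> (f ^^ j) v" if "i < j" "j - i < k" for i j
  proof
    assume "(f ^^ i) v = (f ^^ j) v"
    then have "(f ^^ (j - i)) ((f ^^ i) v) = (f ^^ i) v"
      using that(1) by (metis comp_apply funpow_add le_add_diff_inverse2 less_imp_le)
    then show False
      using that iter[OF v(1)] not_less_Least[OF that(2)[unfolded k_def]] by auto
  qed
  \<comment> \<open>The shift \<open>m = 0\<close> serves the edges, indexed by the vertex they
    leave; \<open>m = 1\<close> serves the vertices they lead to.\<close>
  have inj: "inj_on (\<lambda>i. (f ^^ (i + m)) v) {0..<k}" for m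
  proof (rule linorder_inj_onI)
    fix i j assume "i < j" "i \<in> {0..<k}" "j \<in> {0..<k}"
    then show "(f ^^ (i + m)) v \<noteq> (f ^^ (j + m)) v" by (intro no) auto
  qed auto
  let ?p = "map (\<lambda>i. (t ((f ^^ i) v), (f ^^ Suc i) v)) [0..<k]"
  have "walk G v ?p v" using walk_iterate[of G f t, OF step v(1), of k] v(2) by simp
  moreover have "inj_on (\<lambda>i. t ((f ^^ i) v)) {0..<k}"
    using inj[of 0] iter[OF v(1)] bij_betw_imp_inj_on[OF t]
    by (auto simp: inj_on_def)
  then have "distinct (map fst ?p)" by (simp add: comp_def distinct_map)
  moreover have "distinct (map snd ?p)"
    using inj[of 1] by (simp add: comp_def distinct_map)
  ultimately have "is_cycle G v ?p" using k by (simp add: is_cycle_def)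
  then show ?thesis by blast
qed

section \<open>Connected multigraphs\<close>

text \<open>The first step of the walk that leaves \<open>S\<close> uses such an edge.\<close>

lemma walk_leaves_set:
  "walk G u p v \<Longrightarrow> u \<in> S \<Longrightarrow> v \<notin> S \<Longrightarrow>
    \<exists>e\<in>medges G. \<exists>x\<in>S. \<exists>y\<in>mverts G - S. mends G e = {x, y}"
proof (induction G u p v rule: walk.induct)
  case (1 G u v)
  then show ?case by simp
next
  case (2 G u e w p v)
  show ?case
  proof (cases "w \<in> S")
    case True
    then show ?thesis using 2 by simp
  next
    case False
    then show ?thesis using 2(2,3) walk_ends[of G w p v] by auto
  qed
qed

text \<open>Leaves are attached to \<open>(S, F)\<close> until all vertices are reached.\<close>

lemma connected_extend:
  assumes conn: "connected_mgraph G" and fin: "finite (mverts G)"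
    and "S \<subseteq> mverts G" "S \<noteq> {}" "finite F" "F \<subseteq> medges G" "\<And>e. e \<in> F \<Longrightarrow> mends G e \<subseteq> S"
  shows "\<exists>F'\<subseteq>medges G. finite F' \<and> card F' + card S = card F + card (mverts G) \<and>
    card (transversals (mends G) F' (mverts G)) = card (transversals (mends G) F S)"
  using assms(3-)
proof (induction "card (mverts G - S)" arbitrary: S F)
  case 0
  then have "S = mverts G" using fin by auto
  then show ?case using 0 by blast
next
  case (Suc n)
  have "mverts G - S \<noteq> {}" using Suc(2) by force
  then obtain s t where st: "s \<in> S" "t \<in> mverts G" "t \<notin> S" using Suc.prems(2) by blast
  then obtain p where "walk G s p t"
    using conn Suc.prems(1) unfolding connected_mgraph_def by blast
  from walk_leaves_set[OF this st(1,3)] obtain e x y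
    where e: "e \<in> medges G" "x \<in> S" "y \<in> mverts G - S" "mends G e = {x, y}" by blast
  \<comment> \<open>The end \<open>y\<close> of \<open>e\<close> lies outside \<open>S\<close>,
    while all edges in \<open>F\<close> stay inside; so \<open>e\<close> is new and \<open>y\<close>
    becomes a leaf.\<close>
  have eF: "e \<notin> F" using e Suc.prems(5) by blast
  have finS: "finite S" using Suc.prems(1) fin finite_subset by blast
  have "mverts G - insert y S = (mverts G - S) - {y}" by blast
  then have "n = card (mverts G - insert y S)"
    using Suc(2) e(3) fin by (simp add: card_Diff_singleton)
  then have "\<exists>F'\<subseteq>medges G. finite F' \<and>
      card F' + card (insert y S) = card (insert e F) + card (mverts G) \<and>
      card (transversals (mends G) F' (mverts G)) =
      card (transversals (mends G) (insert e F) (insert y S))"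
  proof (rule Suc(1))
    show "mends G f \<subseteq> insert y S" if "f \<in> insert e F" for f
      using that e(2,4) Suc.prems(5) by auto
  qed (use e Suc.prems in auto)
  moreover have "card (transversals (mends G) (insert e F) (insert y S)) =
      card (transversals (mends G) F S)"
  proof (rule card_transversals_leaf)
    show "y \<notin> mends G f" if "f \<in> F" for f using Suc.prems(5)[OF that] e(3) by blast
  qed (use e eF finS Suc.prems(3) in auto)
  ultimately show ?case using eF e(3) finS Suc.prems(3) by simp
qed

section \<open>Connected multigraphs containing a cycle\<close>

text \<open>The extension starts from the cycle itself, which has equally many edges and vertices
  and two transversals; attaching leaves preserves both facts.\<close>

lemma connected_cycle_extend:
  assumes conn: "connected_mgraph G" and cyc: "is_cycle G u p" and fin: "finite (mverts G)"
    and card2: "\<And>e. e \<in> medges G \<Longrightarrow> card (mends G e) = 2"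
  shows "\<exists>F\<subseteq>medges G. finite F \<and> card F = card (mverts G) \<and>
    card (transversals (mends G) F (mverts G)) = 2"
proof -
  have p: "walk G u p u" "p \<noteq> []" "distinct (map fst p)" "distinct (map snd p)"
    using cyc by (auto simp: is_cycle_def)
  \<comment> \<open>The walk closes up, so its start is also the last vertex it leads to.\<close>
  have "u \<in> snd ` set p"
    using walk_last[OF p(1)] last_in_set[of "map snd p"] p(2) by simp
  then have ends: "mends G e \<subseteq> snd ` set p" if "e \<in> fst ` set p" for e
    using walk_mends_subset[OF p(1) that] by blast
  have "card (fst ` set p) = card (snd ` set p)"
    using distinct_card[OF p(3)] distinct_card[OF p(4)] by simp
  then show ?thesis
    using connected_extend[OF conn fin walk_mverts[OF p(1)] _ _ walk_medges[OF p(1)] ends]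
      card_transversals_cycle[OF cyc card2] p(2) by auto
qed

lemma connected_cycle_card_le:
  assumes "connected_mgraph G" "is_cycle G u p" "finite (mverts G)" "finite (medges G)"
    and "\<And>e. e \<in> medges G \<Longrightarrow> card (mends G e) = 2"
  shows "card (mverts G) \<le> card (medges G)"
  using connected_cycle_extend[OF assms(1-3,5)] card_mono[OF assms(4)] by metis

text \<open>The edge set built from the cycle has as many elements as there are edges in all, so it
  is the whole edge set.\<close>

lemma card_transversals_unicyclic:
  assumes "connected_mgraph G" "is_cycle G u p" "finite (mverts G)" "finite (medges G)"
    and "\<And>e. e \<in> medges G \<Longrightarrow> card (mends G e) = 2"
    and "card (medges G) = card (mverts G)"
  shows "card (transversals (mends G) (medges G) (mverts G)) = 2"
  using connected_cycle_extend[OF assms(1-3,5)] card_subset_eq[OF assms(4)] assms(6) by metis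

section \<open>Components\<close>

lemma equiv_linked: "equiv (mverts G) (linked G)"
proof (rule equivI)
  show "linked G \<subseteq> mverts G \<times> mverts G" by (auto simp: linked_def dest: walk_ends)
  show "refl_on (mverts G) (linked G)"
    by (auto simp: refl_on_def linked_def intro: exI[of _ "[]"])
  show "sym (linked G)" by (auto simp: sym_def linked_def dest: walk_rev)
  show "trans (linked G)" by (auto simp: trans_def linked_def dest: walk_append)
qed

text \<open>Each step joins linked vertices, so a walk never leaves the class it starts in.\<close>

lemma walk_induced:
  "walk G u p v \<Longrightarrow> X \<in> mverts G // linked G \<Longrightarrow> u \<in> X \<Longrightarrow> walk (induced_mgraph G X) u p v"
proof (induction G u p v rule: walk.induct)
  case (1 G u v)
  then show ?case by (simp add: induced_mgraph_def)
next
  case (2 G u e w p v)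
  have "walk G u [(e, w)] w" using 2(2) walk_ends[of G w p v] by auto
  then have "(u, w) \<in> linked G" unfolding linked_def by blast
  then have "w \<in> X" using in_quotient_imp_closed[OF equiv_linked 2(3,4)] by blast
  then show ?case using 2 by (simp add: induced_mgraph_def)
qed

lemma connected_component:
  assumes "X \<in> mverts G // linked G"
  shows "connected_mgraph (induced_mgraph G X)"
  unfolding connected_mgraph_def
proof (intro conjI ballI)
  show "mverts (induced_mgraph G X) \<noteq> {}"
    using in_quotient_imp_non_empty[OF equiv_linked assms] by (simp add: induced_mgraph_def)
  fix u v assume "u \<in> mverts (induced_mgraph G X)" "v \<in> mverts (induced_mgraph G X)"
  then have u: "u \<in> X" and v: "v \<in> X" by (auto simp: induced_mgraph_def)
  then have "(u, v) \<in> linked G"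
    using quotient_eq_iff[OF equiv_linked assms assms] by blast
  then obtain p where "walk G u p v" unfolding linked_def by blast
  then show "\<exists>p. walk (induced_mgraph G X) u p v"
    using walk_induced[OF _ assms u] by blast
qed

lemma edge_in_component:
  assumes "e \<in> medges G" "mends G e \<subseteq> mverts G" "card (mends G e) = 2"
  shows "\<exists>X\<in>mverts G // linked G. mends G e \<subseteq> X"
proof -
  obtain u w where uw: "mends G e = {u, w}" using assms(3) by (auto simp: card_2_iff)
  then have u: "u \<in> mverts G" and "walk G u [(e, w)] w" using assms by auto
  then have "(u, w) \<in> linked G" unfolding linked_def by blast
  then have "mends G e \<subseteq> linked G `` {u}"
    using equiv_class_self[OF equiv_linked u] unfolding uw by blast
  then show ?thesis using quotientI[OF u] by blast
qed

section \<open>The count for a finite loopless multigraph\<close>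

text \<open>This isolates what the argument needs of \<open>G\<^sub>W\<close>: finiteness, two
  distinct ends for every edge, and as many edges as vertices.\<close>

theorem card_transversals_mgraph:
  assumes finV: "finite (mverts G)" and finE: "finite (medges G)"
    and ends: "\<And>e. e \<in> medges G \<Longrightarrow> mends G e \<subseteq> mverts G \<and> card (mends G e) = 2"
    and eq: "card (medges G) = card (mverts G)"
  shows "card (transversals (mends G) (medges G) (mverts G)) =
    (if \<forall>K\<in>mcomponents G. \<not> is_tree K then 2 ^ card (mcomponents G) else 0)"
proof -
  let ?P = "mverts G // linked G"
  let ?E = "\<lambda>X. medges (induced_mgraph G X)"
  let ?t = "\<lambda>X. card (transversals (mends G) (?E X) X)"
  have finP: "finite ?P"
    using finV equiv_linked finite_quotient by (metis equiv_type)
  have V: "mverts G = (\<Union>X\<in>?P. X)" using Union_quotient[OF equiv_linked, of G] by simp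
  have E: "medges G = (\<Union>X\<in>?P. ?E X)"
  proof
    show "medges G \<subseteq> (\<Union>X\<in>?P. ?E X)"
    proof
      fix e assume e: "e \<in> medges G"
      then obtain X where "X \<in> ?P" "mends G e \<subseteq> X"
        using edge_in_component[OF e] ends[OF e] by auto
      then show "e \<in> (\<Union>X\<in>?P. ?E X)" using e by (auto simp: induced_mgraph_def)
    qed
  qed (auto simp: induced_mgraph_def)
  have disjV: "disjoint_family_on (\<lambda>X. X) ?P"
    using quotient_disj[OF equiv_linked] by (auto simp: disjoint_family_on_def)
  have disjE: "disjoint_family_on ?E ?P"
    unfolding disjoint_family_on_def
  proof (intro ballI impI)
    fix X Y assume XY: "X \<in> ?P" "Y \<in> ?P" "X \<noteq> Y"
    \<comment> \<open>The ends would lie in two disjoint classes at once, but every edge has two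
      ends.\<close>
    have "mends G e = {}" if "e \<in> ?E X \<inter> ?E Y" for e
      using that quotient_disj[OF equiv_linked XY(1,2)] XY(3) by (auto simp: induced_mgraph_def)
    moreover have "mends G e \<noteq> {}" if "e \<in> ?E X" for e
      using that ends[of e] by (auto simp: induced_mgraph_def)
    ultimately show "?E X \<inter> ?E Y = {}" by blast
  qed
  have sub: "X \<subseteq> mverts G" "?E X \<subseteq> medges G" if "X \<in> ?P" for X
    using that V by (auto simp: induced_mgraph_def)
  have finX: "finite X" "finite (?E X)" if "X \<in> ?P" for X
    using sub[OF that] finV finE finite_subset by blast+
  have prod: "card (transversals (mends G) (medges G) (mverts G)) = (\<Prod>X\<in>?P. ?t X)"
    using card_transversals_UN[OF finP disjV disjE, of "mends G"]
    unfolding V[symmetric] E[symmetric] by (simp add: induced_mgraph_def)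
  \<comment> \<open>A component determines its class as its vertex set, so components and classes
    are equally many.\<close>
  have "inj_on (induced_mgraph G) ?P"
    by (rule inj_on_inverseI[of _ mverts]) (simp add: induced_mgraph_def)
  then have n: "card (mcomponents G) = card ?P"
    unfolding mcomponents_def by (rule card_image)
  have [simp]: "mverts (induced_mgraph G X) = X" "mends (induced_mgraph G X) = mends G" for X
    by (simp_all add: induced_mgraph_def)
  have ends_X: "mends G e \<subseteq> X \<and> card (mends G e) = 2" if "e \<in> ?E X" for e X
    using that ends by (auto simp: induced_mgraph_def)
  show ?thesis
  proof (cases "\<forall>K\<in>mcomponents G. \<not> is_tree K")
    case True
    have cyc: "\<exists>u p. is_cycle (induced_mgraph G X) u p" if "X \<in> ?P" for X
      using True that connected_component[OF that] by (auto simp: mcomponents_def is_tree_def)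
    have le: "card X \<le> card (?E X)" if X: "X \<in> ?P" for X
    proof -
      obtain u p where "is_cycle (induced_mgraph G X) u p" using cyc[OF X] by blast
      from connected_cycle_card_le[OF connected_component[OF X] this] show ?thesis
        using finX[OF X] ends_X by simp
    qed
    have "(\<Sum>X\<in>?P. card X) = card (mverts G)"
      using card_UN_disjoint'[OF disjV finX(1) finP] unfolding V[symmetric] by simp
    also have "\<dots> = (\<Sum>X\<in>?P. card (?E X))"
      using card_UN_disjoint'[OF disjE finX(2) finP] eq unfolding E[symmetric] by simp
    \<comment> \<open>Two equal sums that compare termwise agree in every term.\<close>
    finally have eqX: "card (?E X) = card X" if "X \<in> ?P" for X
      using sum_mono_inv[of card ?P "\<lambda>X. card (?E X)", OF _ le that finP] by simp
    have "?t X = 2" if X: "X \<in> ?P" for X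
    proof -
      obtain u p where "is_cycle (induced_mgraph G X) u p" using cyc[OF X] by blast
      from card_transversals_unicyclic[OF connected_component[OF X] this] show ?thesis
        using finX[OF X] ends_X eqX[OF X] by simp
    qed
    then have "(\<Prod>X\<in>?P. ?t X) = 2 ^ card ?P" by simp
    then show ?thesis using True prod n by simp
  next
    case False
    then obtain X where X: "X \<in> ?P" and tree: "is_tree (induced_mgraph G X)"
      by (auto simp: mcomponents_def)
    \<comment> \<open>A transversal would produce a cycle in the tree; this covers isolated vertices
      too. The product then has a zero factor.\<close>
    have "transversals (mends G) (?E X) X = {}"
    proof (rule ccontr)
      assume "transversals (mends G) (?E X) X \<noteq> {}"
      then obtain \<sigma> where "\<sigma> \<in> transversals (mends G) (?E X) X" by blast
      then have "\<exists>u p. is_cycle (induced_mgraph G X) u p"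
        using transversal_imp_cycle[of \<sigma> "induced_mgraph G X"] finX[OF X] ends_X
          in_quotient_imp_non_empty[OF equiv_linked X] by simp
      then show False using tree by (simp add: is_tree_def)
    qed
    then have "(\<Prod>X\<in>?P. ?t X) = 0" using finP X by (intro prod_zero bexI[of _ X]) auto
    then show ?thesis using False prod by simp
  qed
qed

section \<open>Application to MacMahon cubes\<close>

theorem theorem6:
  fixes W :: "cube set" and n :: nat
  assumes "W \<subseteq> macmahon_cubes"
    and "card W = 8"
    and "card (medges (G_of W)) = 8"
    and "n = card (mcomponents (G_of W))"
  shows "solution_number Ba W =
    (if \<forall>K\<in>mcomponents (G_of W). \<not> is_tree K then 2 ^ n else 0)"
proof -
  have finW: "finite W" using assms(2) card.infinite by fastforce
  have "medges (G_of W) \<subseteq> W" by (simp add: G_of_def)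
  \<comment> \<open>The eight edges are labeled by elements of the eight-element set
    \<open>W\<close>, so every cube in \<open>W\<close> is an edge; in particular \<open>Ba\<close>
    is not in \<open>W\<close>.\<close>
  then have W: "medges (G_of W) = W"
    using card_subset_eq[OF finW] assms(2,3) by simp
  have V: "mverts (G_of W) = corner_numbers Ba"
    and N: "mends (G_of W) = (\<lambda>C. corner_numbers C \<inter> corner_numbers Ba)"
    by (simp_all add: G_of_def M_def)
  have card2: "card (corner_numbers C \<inter> corner_numbers Ba) = 2" if "C \<in> W" for C
  proof -
    have "C \<in> medges (G_of W)" using W that by simp
    then show ?thesis by (simp add: G_of_def M_def)
  qed
  \<comment> \<open>Intersecting with the corner numbers of \<open>Ba\<close> changes nothing, since
    the bijections already take their values there.\<close>
  have "solutions Ba W = transversals (mends (G_of W)) (medges (G_of W)) (mverts (G_of W))"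
    unfolding W V N by (auto simp: solutions_def transversals_def dest: bij_betwE)
  moreover have "card (corner_numbers Ba) = 8" by (simp add: Ba(2))
  ultimately show ?thesis
    unfolding solution_number_def assms(4)
    by (simp only:, intro card_transversals_mgraph)
      (use W V N finW card2 assms(2) in \<open>auto simp: Ba(2)\<close>)
qed

end
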